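(* Let $\mathbb F=\mathbb R$ or $\mathbb F=\mathbb C$, let $n\ge 1$, and let $p$ be a monic polynomial of degree $n$ over $\mathbb F$. Then there is a monic polynomial $q$ of degree $n-1$ over $\mathbb F$ such that $p$ and $q$ form an irreducible tridiagonal pair (ITrP) over $\mathbb F$.
   Context: A normalized tridiagonal matrix over $\mathbb F$ is an $n\times n$ matrix $A$ with diagonal entries $a_1,\dots,a_n\in\mathbb F$, all superdiagonal entries (positions $(i,i+1)$) equal to $1$, subdiagonal entries (positions $(i+1,i)$) $b_1,\dots,b_{n-1}\in\mathbb F$, and all other entries $0$. It is irreducible if $b_i\neq 0$ for all $i=1,\dots,n-1$. $A(1)$ denotes the trailing $(n-1)\times(n-1)$ principal submatrix of $A$ (delete the first row and column); the characteristic polynomial of the empty matrix is $1$. Monic polynomials $p,q$ over $\mathbb F$ of degrees $n,n-1$ form an irreducible tridiagonal pair (ITrP) if there is an irreducible normalized tridiagonal $n\times n$ matrix $A$ over $\mathbb F$ with $\det(tI-A)=p(t)$ and $\det(tI-A(1))=q(t)$. *)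

theory Defs
  imports "Jordan_Normal_Form.Char_Poly"
begin

text \<open>Matrix indices start at 0.\<close>

definition normalized_tridiagonal :: "nat \<Rightarrow> 'a :: field mat \<Rightarrow> bool" where
  "normalized_tridiagonal n A \<longleftrightarrow>
     A \<in> carrier_mat n n \<and>
     (\<forall>i. Suc i < n \<longrightarrow> A $$ (i, Suc i) = 1) \<and>
     (\<forall>i<n. \<forall>j<n. i \<noteq> j \<and> j \<noteq> Suc i \<and> i \<noteq> Suc j \<longrightarrow> A $$ (i, j) = 0)"

definition irreducible_normalized_tridiagonal :: "nat \<Rightarrow> 'a :: field mat \<Rightarrow> bool" where
  "irreducible_normalized_tridiagonal n A \<longleftrightarrow>
     normalized_tridiagonal n A \<and> (\<forall>i. Suc i < n \<longrightarrow> A $$ (Suc i, i) \<noteq> 0)"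

text \<open>\<open>mat_delete A 0 0\<close> is the trailing principal submatrix. For \<open>n = 1\<close> it is the empty
  matrix, whose \<open>char_poly\<close> is 1. The conjunct \<open>1 \<le> n\<close> keeps the subtraction \<open>n - 1\<close> on
  \<open>nat\<close> from truncating.\<close>

definition ITrP :: "nat \<Rightarrow> 'a :: field poly \<Rightarrow> 'a poly \<Rightarrow> bool" where
  "ITrP n p q \<longleftrightarrow>
     1 \<le> n \<and> monic p \<and> degree p = n \<and> monic q \<and> degree q = n - 1 \<and>
     (\<exists>A. irreducible_normalized_tridiagonal n A \<and>
          char_poly A = p \<and> char_poly (mat_delete A 0 0) = q)"

end

theory Submission
  imports Defs
begin

text \<open>
  Let \<open>L\<close> be a linear functional on polynomials that vanishes on the multiples of \<open>p\<close>, and suppose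
  that for every \<open>k\<close> in \<open>{1..n}\<close> the bilinear form \<open>(f, g) \<mapsto> L (f g)\<close> is nondegenerate on the
  polynomials of degree less than \<open>k\<close>. Then the monic orthogonal polynomials \<open>P\<^sub>0, \<dots>, P\<^sub>n\<close> of \<open>L\<close>
  exist and satisfy a three-term recurrence \<open>P\<^sub>k\<^sub>+\<^sub>1 = (t - a) P\<^sub>k - b P\<^sub>k\<^sub>-\<^sub>1\<close> with \<open>b \<noteq> 0\<close>.
  Expanding a determinant along its first row shows that this recurrence is exactly what happens to
  the pair of characteristic polynomials when a row and a column are put in front of a
  tridiagonal matrix (\<open>ITrP_extend\<close>). So \<open>P\<^sub>n\<close> and \<open>P\<^sub>n\<^sub>-\<^sub>1\<close> form an irreducible tridiagonal
  pair. Finally \<open>p\<close> and \<open>P\<^sub>n\<close> are both monic of degree \<open>n\<close> and orthogonal to all polynomials of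
  lower degree, hence equal by nondegeneracy at level \<open>n\<close>.

  It remains to find \<open>L\<close>. The functionals that vanish on the multiples of \<open>p\<close> form a vector space
  of dimension \<open>n\<close>, with coordinates \<open>c\<^sub>0, \<dots>, c\<^sub>n\<^sub>-\<^sub>1\<close>. Nondegeneracy at level \<open>k\<close> means that the
  Hankel determinant of the moments \<open>L (t\<^sup>i\<^sup>+\<^sup>j)\<close>, \<open>i, j < k\<close>, is nonzero; this determinant is a
  polynomial in \<open>c\<close>, and it is not identically zero because the functional "coefficient of
  \<open>t\<^sup>k\<^sup>-\<^sup>1\<close> of the remainder modulo \<open>p\<close>" makes the Hankel matrix anti-triangular
  (\<open>nondegenerate_residue_coeff\<close>). Finitely many nonzero polynomials over an infinite field have a
  common non-root (\<open>exists_common_nonzero\<close>). The argument therefore works over every infinite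
  field.
\<close>

section \<open>Prepending a row and a column to a tridiagonal matrix\<close>

definition tridiagonal_extend :: "'a :: field \<Rightarrow> 'a \<Rightarrow> nat \<Rightarrow> 'a mat \<Rightarrow> 'a mat" where
  "tridiagonal_extend a b k A = mat (Suc k) (Suc k) (\<lambda>(i, j).
     if i = 0 then (if j = 0 then a else if j = 1 then 1 else 0)
     else if j = 0 then (if i = 1 then b else 0)
     else A $$ (i - 1, j - 1))"

lemma tridiagonal_extend_carrier [simp]:
  "tridiagonal_extend a b k A \<in> carrier_mat (Suc k) (Suc k)"
  by (simp add: tridiagonal_extend_def)

lemma mat_delete_tridiagonal_extend:
  "A \<in> carrier_mat k k \<Longrightarrow> mat_delete (tridiagonal_extend a b k A) 0 0 = A"
  by (rule eq_matI) (auto simp: mat_delete_def tridiagonal_extend_def)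

lemma irreducible_tridiagonal_extend:
  assumes "irreducible_normalized_tridiagonal k A" "b \<noteq> 0"
  shows "irreducible_normalized_tridiagonal (Suc k) (tridiagonal_extend a b k A)"
proof -
  have A: "A $$ (i, Suc i) = 1" "A $$ (Suc i, i) \<noteq> 0" if "Suc i < k" for i
    using assms that
    by (auto simp: irreducible_normalized_tridiagonal_def normalized_tridiagonal_def)
  have A0: "A $$ (i, j) = 0" if "i < k" "j < k" "i \<noteq> j" "j \<noteq> Suc i" "i \<noteq> Suc j" for i j
    using assms(1) that
    by (auto simp: irreducible_normalized_tridiagonal_def normalized_tridiagonal_def)
  have "tridiagonal_extend a b k A $$ (i, Suc i) = 1" if "Suc i < Suc k" for i
    using that A(1)[of "i - 1"] by (cases i) (auto simp: tridiagonal_extend_def)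
  moreover have "tridiagonal_extend a b k A $$ (Suc i, i) \<noteq> 0" if "Suc i < Suc k" for i
    using that A(2)[of "i - 1"] assms(2) by (cases i) (auto simp: tridiagonal_extend_def)
  moreover have "tridiagonal_extend a b k A $$ (i, j) = 0"
    if "i < Suc k" "j < Suc k" "i \<noteq> j" "j \<noteq> Suc i" "i \<noteq> Suc j" for i j
    using that A0[of "i - 1" "j - 1"]
    by (cases i; cases j) (auto simp: tridiagonal_extend_def)
  ultimately show ?thesis
    by (auto simp: irreducible_normalized_tridiagonal_def normalized_tridiagonal_def)
qed

text \<open>
  Only two entries of the first row of \<open>t I - A\<close> are nonzero. The minor of the second one has a
  first column with the single nonzero entry \<open>-b\<close>, which is where \<open>A(1)\<close> enters.
\<close>

lemma char_poly_tridiagonal_extend: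
  assumes A: "A \<in> carrier_mat k k" and k: "k \<ge> 1"
  shows "char_poly (tridiagonal_extend a b k A) =
    [:-a, 1:] * char_poly A - Polynomial.smult b (char_poly (mat_delete A 0 0))"
proof -
  define M where "M = char_poly_matrix (tridiagonal_extend a b k A)"
  define N where "N = mat_delete M 0 1"
  have dA: "dim_row A = k" "dim_col A = k"
    using A by auto
  have M: "M \<in> carrier_mat (Suc k) (Suc k)"
    unfolding M_def by simp
  have N: "N \<in> carrier_mat k k"
    using M unfolding N_def by (simp add: mat_delete_def)
  have M00: "M $$ (0, 0) = [:-a, 1:]" and M01: "M $$ (0, 1) = [:-1:]"
    and M0: "\<And>j. 2 \<le> j \<Longrightarrow> j < Suc k \<Longrightarrow> M $$ (0, j) = 0"
    using k by (auto simp: M_def char_poly_matrix_def tridiagonal_extend_def)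
  have del0: "mat_delete M 0 0 = char_poly_matrix A"
    unfolding M_def
    by (rule eq_matI)
       (auto simp: char_poly_matrix_def mat_delete_def tridiagonal_extend_def dA)
  have del1: "mat_delete N 0 0 = char_poly_matrix (mat_delete A 0 0)"
    using k unfolding N_def M_def
    by (intro eq_matI)
       (auto simp: char_poly_matrix_def mat_delete_def tridiagonal_extend_def dA)
  have N00: "N $$ (0, 0) = [:-b:]" and N0: "\<And>i. 0 < i \<Longrightarrow> i < k \<Longrightarrow> N $$ (i, 0) = 0"
    using k by (auto simp: N_def M_def char_poly_matrix_def mat_delete_def tridiagonal_extend_def)
  have "det N = (\<Sum>i<k. N $$ (i, 0) * cofactor N i 0)"
    using laplace_expansion_column[OF N, of 0] k by simp
  also have "\<dots> = (\<Sum>i\<in>{0}. N $$ (i, 0) * cofactor N i 0)"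
    using k N0 by (intro sum.mono_neutral_right) auto
  also have "\<dots> = [:-b:] * char_poly (mat_delete A 0 0)"
    by (simp add: N00 cofactor_def del1 char_poly_def)
  finally have detN: "det N = [:-b:] * char_poly (mat_delete A 0 0)" .
  have "det M = (\<Sum>j<Suc k. M $$ (0, j) * cofactor M 0 j)"
    using laplace_expansion_row[OF M, of 0] by simp
  also have "\<dots> = (\<Sum>j\<in>{0, 1}. M $$ (0, j) * cofactor M 0 j)"
    using k M0 by (intro sum.mono_neutral_right) auto
  also have "\<dots> = [:-a, 1:] * char_poly A + det N"
    using M00 M01 by (simp add: cofactor_def del0 char_poly_def N_def)
  finally show ?thesis
    by (simp add: detN char_poly_def M_def)
qed

lemma monic_char_poly_mat_delete:
  assumes "A \<in> carrier_mat n n"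
  shows "monic (char_poly (mat_delete A 0 0))" "degree (char_poly (mat_delete A 0 0)) = n - 1"
  using degree_monic_char_poly[of "mat_delete A 0 0" "n - 1"] assms
  by (auto simp: mat_delete_def)

lemma ITrP_intro:
  assumes "irreducible_normalized_tridiagonal n A" "n \<ge> 1"
  shows "ITrP n (char_poly A) (char_poly (mat_delete A 0 0))"
proof -
  have A: "A \<in> carrier_mat n n"
    using assms(1) by (simp add: irreducible_normalized_tridiagonal_def normalized_tridiagonal_def)
  show ?thesis
    using assms degree_monic_char_poly[OF A] monic_char_poly_mat_delete[OF A]
    unfolding ITrP_def by auto
qed

lemma ITrP_extend:
  assumes "ITrP k P Q" "b \<noteq> 0"
  shows "ITrP (Suc k) ([:-a, 1:] * P - Polynomial.smult b Q) P"
proof -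
  obtain A where A: "irreducible_normalized_tridiagonal k A" "char_poly A = P"
      "char_poly (mat_delete A 0 0) = Q" and k: "k \<ge> 1"
    using assms(1) by (auto simp: ITrP_def)
  have cA: "A \<in> carrier_mat k k"
    using A(1) by (simp add: irreducible_normalized_tridiagonal_def normalized_tridiagonal_def)
  show ?thesis
    using ITrP_intro[OF irreducible_tridiagonal_extend[OF A(1) assms(2), of a]]
    by (simp add: char_poly_tridiagonal_extend[OF cA k] mat_delete_tridiagonal_extend[OF cA] A)
qed

lemma ITrP_one: "ITrP 1 [:-a, 1:] 1"
proof -
  define A where "A = mat 1 1 (\<lambda>_. a)"
  have "irreducible_normalized_tridiagonal 1 A"
    by (auto simp: irreducible_normalized_tridiagonal_def normalized_tridiagonal_def A_def)
  moreover have "char_poly A = [:-a, 1:]"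
    by (simp add: char_poly_def char_poly_matrix_def det_single A_def)
  moreover have "char_poly (mat_delete A 0 0) = 1"
    by (simp add: char_poly_def char_poly_matrix_def det_dim_zero A_def mat_delete_def)
  ultimately show ?thesis
    using ITrP_intro[of 1 A] by simp
qed


section \<open>Orthogonal polynomials of a linear functional\<close>

definition orthogonal_below :: "('a :: field poly \<Rightarrow> 'a) \<Rightarrow> nat \<Rightarrow> 'a poly \<Rightarrow> bool" where
  "orthogonal_below L k f \<longleftrightarrow> (\<forall>j<k. L (f * monom 1 j) = 0)"

text \<open>
  The form \<open>(f, g) \<mapsto> L (f g)\<close>, restricted to the polynomials of degree less than \<open>k\<close>, has
  trivial radical.
\<close>

definition nondegenerate :: "('a :: field poly \<Rightarrow> 'a) \<Rightarrow> nat \<Rightarrow> bool" where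
  "nondegenerate L k \<longleftrightarrow> (\<forall>f. degree f < k \<longrightarrow> orthogonal_below L k f \<longrightarrow> f = 0)"

definition hankel :: "('a :: field poly \<Rightarrow> 'a) \<Rightarrow> nat \<Rightarrow> 'a mat" where
  "hankel L k = mat k k (\<lambda>(i, j). L (monom 1 (i + j)))"

locale poly_functional =
  fixes L :: "'a :: field poly \<Rightarrow> 'a"
  assumes add: "L (f + g) = L f + L g"
    and smult: "L (Polynomial.smult c f) = c * L f"
begin

lemma zero [simp]: "L 0 = 0"
  using smult[of 0 0] by simp

lemma diff: "L (f - g) = L f - L g"
  using add[of "f - g" g] by simp

lemma sum: "L (\<Sum>i\<in>I. f i) = (\<Sum>i\<in>I. L (f i))"
  by (induction I rule: infinite_finite_induct) (auto simp: add)

lemma L_mult_monom: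
  assumes "degree f < k"
  shows "L (f * monom 1 i) = (\<Sum>j<k. L (monom 1 (i + j)) * coeff f j)"
proof -
  have "f = (\<Sum>j\<le>k - 1. monom (coeff f j) j)"
    using assms by (simp add: poly_as_sum_of_monoms')
  also have "{..k - 1} = {..<k}"
    using assms by auto
  finally have "f * monom 1 i = (\<Sum>j<k. Polynomial.smult (coeff f j) (monom 1 (i + j)))"
    by (metis (no_types, lifting) sum_distrib_right mult_monom smult_monom mult.right_neutral
        add.commute sum.cong)
  then show ?thesis
    by (simp add: sum smult mult.commute)
qed

text \<open>
  The Hankel matrix is the Gram matrix of the form \<open>L (f g)\<close> in the basis \<open>1, t, \<dots>, t\<^sup>k\<^sup>-\<^sup>1\<close>, so its
  kernel consists of the coefficient vectors of the polynomials in the radical of the form.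
\<close>

lemma det_hankel_iff_nondegenerate: "det (hankel L k) \<noteq> 0 \<longleftrightarrow> nondegenerate L k"
proof -
  have H: "hankel L k \<in> carrier_mat k k"
    by (simp add: hankel_def)
  have row: "(hankel L k *\<^sub>v vec k (coeff f)) $ i = L (f * monom 1 i)"
    if "degree f < k" "i < k" for f i
    using that
    by (simp add: hankel_def L_mult_monom scalar_prod_def atLeast0LessThan)
  have "det (hankel L k) = 0 \<longleftrightarrow> \<not> nondegenerate L k"
  proof
    assume "det (hankel L k) = 0"
    then obtain v where v: "v \<in> carrier_vec k" "v \<noteq> 0\<^sub>v k" "hankel L k *\<^sub>v v = 0\<^sub>v k"
      using det_0_iff_vec_prod_zero_field[OF H] by auto
    have k: "k > 0"
      using v(1,2) by (intro gr0I) auto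
    define f where "f = (\<Sum>j<k. monom (v $ j) j)"
    have cf: "coeff f j = (if j < k then v $ j else 0)" for j
      by (auto simp: f_def coeff_sum coeff_monom)
    have deg: "degree f < k"
      using degree_le[of "k - 1" f] cf k by fastforce
    have v_eq: "v = vec k (coeff f)"
      using v(1) by (intro eq_vecI) (auto simp: cf)
    have "orthogonal_below L k f"
      unfolding orthogonal_below_def
      using row[OF deg] v(3) by (simp flip: v_eq)
    moreover have "f \<noteq> 0"
      using v(2) v_eq by (auto simp: zero_vec_def)
    ultimately show "\<not> nondegenerate L k"
      using deg by (auto simp: nondegenerate_def)
  next
    assume "\<not> nondegenerate L k"
    then obtain f where f: "degree f < k" "orthogonal_below L k f" "f \<noteq> 0"
      by (auto simp: nondegenerate_def)
    have "hankel L k *\<^sub>v vec k (coeff f) = 0\<^sub>v k"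
      using row[OF f(1)] f(2) H by (intro eq_vecI) (auto simp: orthogonal_below_def)
    moreover have "vec k (coeff f) \<noteq> 0\<^sub>v k"
    proof
      assume "vec k (coeff f) = 0\<^sub>v k"
      then have "vec k (coeff f) $ degree f = 0"
        using f(1) by simp
      then show False
        using f by simp
    qed
    ultimately show "det (hankel L k) = 0"
      using det_0_iff_vec_prod_zero_field[OF H] by (metis vec_carrier)
  qed
  then show ?thesis
    by blast
qed

text \<open>
  The squared norm of an orthogonal polynomial is nonzero, since otherwise the polynomial would be
  in the radical one level higher.
\<close>

lemma norm_nonzero:
  assumes "nondegenerate L (Suc k)" "orthogonal_below L k f" "degree f = k" "f \<noteq> 0"
  shows "L (f * monom 1 k) \<noteq> 0"
  using assms by (auto simp: nondegenerate_def orthogonal_below_def less_Suc_eq)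

lemma L_linear_factor_mult:
  "L (([:-a, 1:] * P - Polynomial.smult b Q) * monom 1 j) =
     L (P * monom 1 (Suc j)) - a * L (P * monom 1 j) - b * L (Q * monom 1 j)"
proof -
  have "([:-a, 1:] * P - Polynomial.smult b Q) * monom 1 j =
     P * monom 1 (Suc j) - Polynomial.smult a (P * monom 1 j) - Polynomial.smult b (Q * monom 1 j)"
    by (simp add: monom_Suc algebra_simps)
  then show ?thesis
    by (simp add: diff smult)
qed

text \<open>
  One step of the three-term recurrence. Against \<open>t\<^sup>j\<close> with \<open>j < k - 1\<close> every term vanishes already;
  \<open>b\<close> is chosen to kill the pairing with \<open>t\<^sup>k\<^sup>-\<^sup>1\<close>, after which \<open>a\<close> is chosen to kill the pairing with
  \<open>t\<^sup>k\<close>. The constant \<open>b\<close> is the quotient of two consecutive squared norms and therefore nonzero.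
\<close>

lemma orthogonal_step:
  assumes nd: "nondegenerate L k" "nondegenerate L (Suc k)"
    and k: "k \<ge> 1"
    and P: "orthogonal_below L k P" "degree P = k" "P \<noteq> 0"
    and Q: "orthogonal_below L (k - 1) Q" "degree Q = k - 1" "Q \<noteq> 0"
  obtains a b where "b \<noteq> 0" "orthogonal_below L (Suc k) ([:-a, 1:] * P - Polynomial.smult b Q)"
proof -
  define nP where "nP = L (P * monom 1 k)"
  define nQ where "nQ = L (Q * monom 1 (k - 1))"
  have nP: "nP \<noteq> 0"
    unfolding nP_def using norm_nonzero[OF nd(2) P] .
  have nQ: "nQ \<noteq> 0"
    unfolding nQ_def using norm_nonzero[of "k - 1" Q] nd(1) Q k by simp
  define b where "b = nP / nQ"
  define a where "a = (L (P * monom 1 (Suc k)) - b * L (Q * monom 1 k)) / nP"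
  have "L (([:-a, 1:] * P - Polynomial.smult b Q) * monom 1 j) = 0" if "j < Suc k" for j
  proof -
    consider "j < k - 1" | "j = k - 1" | "j = k"
      using \<open>j < Suc k\<close> by linarith
    then show ?thesis
    proof cases
      case 1
      then have "Suc j < k" "j < k"
        by auto
      with 1 P(1) Q(1) show ?thesis
        by (simp add: L_linear_factor_mult orthogonal_below_def del: mult_pCons_left)
    next
      case 2
      then have "Suc j = k" "j < k"
        using k by auto
      then have "L (P * monom 1 (Suc j)) = nP" "L (P * monom 1 j) = 0"
          "L (Q * monom 1 j) = nQ"
        using P(1) 2 by (auto simp: nP_def nQ_def orthogonal_below_def)
      then show ?thesis
        using nQ by (simp add: L_linear_factor_mult b_def del: mult_pCons_left)
    next
      case 3
      then show ?thesis
        using nP unfolding L_linear_factor_mult by (simp add: a_def flip: nP_def)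
    qed
  qed
  moreover have "b \<noteq> 0"
    using nP nQ by (simp add: b_def)
  ultimately show thesis
    by (intro that) (auto simp: orthogonal_below_def)
qed

text \<open>
  The matrix grows at its upper left corner, so \<open>P\<close> and \<open>Q\<close> are the orthogonal polynomials of degrees
  \<open>n\<close> and \<open>n - 1\<close>. Both are carried through the induction because the recurrence has two terms of
  memory.
\<close>

lemma exists_orthogonal_ITrP:
  assumes "n \<ge> 1" "\<And>k. 1 \<le> k \<Longrightarrow> k \<le> n \<Longrightarrow> nondegenerate L k"
  shows "\<exists>P Q. ITrP n P Q \<and> orthogonal_below L n P \<and> orthogonal_below L (n - 1) Q"
  using assms
proof (induction n rule: dec_induct)
  case base
  define a where "a = L (monom 1 1) / L 1"
  have "L 1 \<noteq> 0"
    using norm_nonzero[of 0 1] base by (simp add: orthogonal_below_def)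
  moreover have "[:-a, 1:] = monom 1 1 - Polynomial.smult a 1"
    by (simp add: monom_Suc)
  ultimately have "L [:-a, 1:] = 0"
    by (simp only: diff smult a_def) simp
  then have "orthogonal_below L 1 [:-a, 1:]" "orthogonal_below L (1 - 1) 1"
    by (auto simp: orthogonal_below_def)
  then show ?case
    using ITrP_one by blast
next
  case (step k)
  from step.IH step.prems obtain P Q
    where PQ: "ITrP k P Q" "orthogonal_below L k P" "orthogonal_below L (k - 1) Q"
    by auto
  have "degree P = k" "P \<noteq> 0" "degree Q = k - 1" "Q \<noteq> 0"
    using PQ(1) by (auto simp: ITrP_def)
  then obtain a b
    where "b \<noteq> 0" "orthogonal_below L (Suc k) ([:-a, 1:] * P - Polynomial.smult b Q)"
    using orthogonal_step[of k P Q] step.prems step.hyps PQ(2,3)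
    by (metis Suc_eq_plus1 le_add2 le_SucI order_refl)
  then show ?case
    using ITrP_extend[OF PQ(1), of b a] PQ(2) by (metis diff_Suc_1)
qed

end


section \<open>Functionals vanishing on the multiples of a polynomial\<close>

definition residue_functional :: "'a :: field poly \<Rightarrow> (nat \<Rightarrow> 'a) \<Rightarrow> 'a poly \<Rightarrow> 'a" where
  "residue_functional p c f = (\<Sum>i<degree p. c i * coeff (f mod p) i)"

interpretation residue: poly_functional "residue_functional p c" for p c
  by unfold_locales
     (simp_all add: residue_functional_def poly_mod_add_left mod_smult_left algebra_simps
       sum.distrib sum_distrib_left)

lemma residue_functional_multiple [simp]: "residue_functional p c (p * f) = 0"
  by (simp add: residue_functional_def)

text \<open>
  If \<open>f \<noteq> 0\<close> has degree \<open>d < k\<close>, then \<open>f t\<^sup>k\<^sup>-\<^sup>1\<^sup>-\<^sup>d\<close> has degree \<open>k - 1 < degree p\<close>; it is its own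
  remainder, and the functional returns its leading coefficient.
\<close>

lemma nondegenerate_residue_coeff:
  assumes "1 \<le> k" "k \<le> degree p"
  shows "nondegenerate (residue_functional p (\<lambda>i. if i = k - 1 then 1 else 0)) k"
  unfolding nondegenerate_def
proof (intro allI impI, rule ccontr)
  fix f
  assume f: "degree f < k" "f \<noteq> 0"
    and orth: "orthogonal_below (residue_functional p (\<lambda>i. if i = k - 1 then 1 else 0)) k f"
  define j where "j = k - 1 - degree f"
  have j: "j < k" "degree f + j = k - 1"
    using f assms by (auto simp: j_def)
  have "degree (f * monom 1 j) = k - 1"
    using f j by (simp add: degree_mult_eq degree_monom_eq)
  then have "f * monom 1 j mod p = f * monom 1 j"
    using assms by (intro mod_poly_less) auto
  then have "residue_functional p (\<lambda>i. if i = k - 1 then 1 else 0) (f * monom 1 j)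
      = coeff (f * monom 1 j) (k - 1)"
    using assms by (simp add: residue_functional_def if_distrib[of "\<lambda>x. x * _"] cong: if_cong)
  also have "\<dots> = lead_coeff f"
    unfolding j(2)[symmetric] by (simp add: mult.commute[of f] coeff_monom_mult)
  finally show False
    using orth j f by (auto simp: orthogonal_below_def)
qed


section \<open>A generic functional is nondegenerate at all levels\<close>

text \<open>
  A substitute for "a product of nonzero polynomials in several variables has a non-root" that needs
  only polynomials in one variable: each function is required to be polynomial along lines. On the
  line \<open>s \<mapsto> (1 - s) u + s v\<close> from a common non-root \<open>u\<close> of all functions but one to a non-root
  \<open>v\<close> of the last one, every restriction is a nonzero polynomial, being nonzero at \<open>s = 0\<close> or at
  \<open>s = 1\<close>.
\<close>

lemma exists_common_nonzero:
  fixes F :: "'k \<Rightarrow> ('i \<Rightarrow> 'a :: field) \<Rightarrow> 'a"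
  assumes inf: "infinite (UNIV :: 'a set)"
    and K: "finite K"
    and lines: "\<And>k u v. k \<in> K \<Longrightarrow> \<exists>g. \<forall>s. poly g s = F k (\<lambda>i. (1 - s) * u i + s * v i)"
    and nonzero: "\<And>k. k \<in> K \<Longrightarrow> \<exists>v. F k v \<noteq> 0"
  shows "\<exists>v. \<forall>k\<in>K. F k v \<noteq> 0"
  using K lines nonzero
proof (induction K)
  case empty
  then show ?case by simp
next
  case (insert k K)
  obtain u where u: "\<forall>k\<in>K. F k u \<noteq> 0"
    using insert by (meson insertCI)
  obtain v where v: "F k v \<noteq> 0"
    using insert.prems(2) by blast
  have "\<forall>l\<in>insert k K. \<exists>g. \<forall>s. poly g s = F l (\<lambda>i. (1 - s) * u i + s * v i)"
    using insert.prems(1) by blast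
  then obtain g where
    g: "\<And>l s. l \<in> insert k K \<Longrightarrow> poly (g l) s = F l (\<lambda>i. (1 - s) * u i + s * v i)"
    by metis
  have "g l \<noteq> 0" if "l \<in> insert k K" for l
    using g[OF that, of 0] g[OF that, of 1] u v that by auto
  then have "(\<Prod>l\<in>insert k K. g l) \<noteq> 0"
    using insert.hyps by (simp del: prod.insert)
  then obtain s where "poly (\<Prod>l\<in>insert k K. g l) s \<noteq> 0"
    using poly_roots_finite inf by (metis (mono_tags, lifting) Collect_cong UNIV_def)
  then have "\<forall>l\<in>insert k K. poly (g l) s \<noteq> 0"
    using insert.hyps by (simp del: prod.insert add: poly_prod)
  then show ?case
    using g by metis
qed

lemma residue_functional_line:
  "residue_functional p (\<lambda>i. (1 - s) * u i + s * v i) f =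
     (1 - s) * residue_functional p u f + s * residue_functional p v f"
  by (simp add: residue_functional_def sum.distrib sum_distrib_left distrib_right mult.assoc)

lemma det_hankel_polynomial_on_line:
  "\<exists>g. \<forall>s. poly g s = det (hankel (residue_functional p (\<lambda>i. (1 - s) * u i + s * v i)) k)"
proof -
  let ?L = "residue_functional p"
  define M where "M = mat k k (\<lambda>(i, j).
    [:?L u (monom 1 (i + j)), ?L v (monom 1 (i + j)) - ?L u (monom 1 (i + j)):])"
  have "poly (det M) s = det (hankel (residue_functional p (\<lambda>i. (1 - s) * u i + s * v i)) k)" for s
    unfolding hankel_def residue_functional_line
    by (rule poly_det_cong[of _ k]) (auto simp: M_def algebra_simps)
  then show ?thesis
    by blast
qed

lemma exists_nondegenerate_residue_functional:
  fixes p :: "'a :: field poly"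
  assumes "infinite (UNIV :: 'a set)"
  shows "\<exists>c. \<forall>k\<in>{1..degree p}. nondegenerate (residue_functional p c) k"
proof -
  have "\<exists>c. \<forall>k\<in>{1..degree p}. det (hankel (residue_functional p c) k) \<noteq> 0"
  proof (rule exists_common_nonzero[OF assms])
    show "\<exists>c. det (hankel (residue_functional p c) k) \<noteq> 0" if "k \<in> {1..degree p}" for k
      using nondegenerate_residue_coeff[of k p] that
      by (auto simp: residue.det_hankel_iff_nondegenerate)
  qed (auto intro: det_hankel_polynomial_on_line)
  then show ?thesis
    by (simp add: residue.det_hankel_iff_nondegenerate)
qed


section \<open>Every monic polynomial belongs to an irreducible tridiagonal pair\<close>

lemma exists_ITrP:
  fixes p :: "'a :: field poly"
  assumes inf: "infinite (UNIV :: 'a set)" and p: "monic p" "degree p = n" "n \<ge> 1"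
  shows "\<exists>q. ITrP n p q"
proof -
  obtain c where c: "\<And>k. 1 \<le> k \<Longrightarrow> k \<le> n \<Longrightarrow> nondegenerate (residue_functional p c) k"
    using exists_nondegenerate_residue_functional[OF inf, of p] p(2) by (metis atLeastAtMost_iff)
  obtain P Q where PQ: "ITrP n P Q" "orthogonal_below (residue_functional p c) n P"
    using residue.exists_orthogonal_ITrP[OF p(3) c] by blast
  have P: "monic P" "degree P = n"
    using PQ(1) by (auto simp: ITrP_def)
  have "coeff (P - p) i = 0" if "i \<ge> n" for i
    using that P p by (cases "i = n") (auto simp: coeff_eq_0)
  then have "degree (P - p) < n"
    using p(3) degree_le[of "n - 1" "P - p"] by fastforce
  \<comment> \<open>\<open>p\<close> itself is orthogonal to everything, because the functional vanishes on its multiples.\<close>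
  moreover have "orthogonal_below (residue_functional p c) n (P - p)"
    using PQ(2) by (simp add: orthogonal_below_def left_diff_distrib residue.diff)
  ultimately have "P - p = 0"
    using c[of n] p(3) by (auto simp: nondegenerate_def)
  then show ?thesis
    using PQ(1) by auto
qed

theorem theorem2:
  fixes n :: nat
  assumes "n \<ge> 1"
  shows "(\<forall>p :: real poly. monic p \<and> degree p = n \<longrightarrow>
            (\<exists>q :: real poly. monic q \<and> degree q = n - 1 \<and> ITrP n p q)) \<and>
         (\<forall>p :: complex poly. monic p \<and> degree p = n \<longrightarrow>
            (\<exists>q :: complex poly. monic q \<and> degree q = n - 1 \<and> ITrP n p q))"
proof -
  have "\<exists>q. monic q \<and> degree q = n - 1 \<and> ITrP n p q"
    if "monic p" "degree p = n" for p :: "real poly"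
    using exists_ITrP[OF infinite_UNIV_char_0 that assms] by (auto simp: ITrP_def)
  moreover have "\<exists>q. monic q \<and> degree q = n - 1 \<and> ITrP n p q"
    if "monic p" "degree p = n" for p :: "complex poly"
    using exists_ITrP[OF infinite_UNIV_char_0 that assms] by (auto simp: ITrP_def)
  ultimately show ?thesis
    by blast
qed

end
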